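(* Let $\mathcal{H}$ be the Hilbert space of a many-body quantum system with a complete orthonormal basis $\{\Phi_{Ji}\}$ grouped into phase cells indexed by $J$, and let $\overline{\mathcal{A}}_M$ be the set of coarse macro observables associated with it. Let $J\neq J'$ and let $\Psi_1,\Psi_2\in\mathcal{H}$ belong to the single but different phase cells $J$ and $J'$, i.e. $$\Psi_1=\sum_i b^1_{Ji}\Phi_{Ji},\qquad \Psi_2=\sum_{i'} b^2_{J'i'}\Phi_{J'i'} .$$ Put $\Psi:=\Psi_1+\Psi_2$. Then for every coarse macro observable $\overline{A}_M\in\overline{\mathcal{A}}_M$, with eigenvalue $A_K$ on the phase cell $K$, $$\left(\Psi|\overline{A}_M|\Psi\right)=\Big(\sum_i|b^1_{Ji}|^2\Big)A_J+\Big(\sum_{i'}|b^2_{J'i'}|^2\Big)A_{J'}=\left(\Psi_1|\overline{A}_M|\Psi_1\right)+\left(\Psi_2|\overline{A}_M|\Psi_2\right).$$ That is, with respect to $\overline{\mathcal{A}}_M$ the state $\Psi$ has the same expectation values as the (unnormalized) mixture $|\Psi_1\rangle\langle\Psi_1|+|\Psi_2\rangle\langle\Psi_2|$.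
   Context: $\mathcal{H}$ is a complex Hilbert space with a fixed complete orthonormal basis $\{\Phi_{Ji}\}$; the basis vectors come in groups indexed by $J$, with $i$ labelling the vectors inside group $J$. The closed subspace spanned by $\{\Phi_{Ji}\}_i$ is called the phase cell $J$, and $P_J$ is the orthogonal projector onto it. A coarse macro observable is an operator of the form $\overline{A}=\sum_J A_J P_J$ with real numbers $A_J$, so that $\overline{A}\,\Phi_{Ji}=A_J\Phi_{Ji}$ for all $J,i$; in particular all coarse macro observables commute and share the eigenbasis $\{\Phi_{Ji}\}$. $\overline{\mathcal{A}}_M$ denotes the set of coarse macro observables. $(\Psi|A|\Psi)$ denotes the inner product $\langle\Psi,A\Psi\rangle$. *)

theory Defs
  imports "HOL-Analysis.Analysis"
begin

text \<open>Complex Hilbert spaces; as in the physics convention, the inner product is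
  conjugate-linear in its first and linear in its second argument.\<close>

class chilbert_space = banach +
  fixes scaleC :: "complex \<Rightarrow> 'a \<Rightarrow> 'a"  (infixr \<open>*\<^sub>C\<close> 75)
    and cinner :: "'a \<Rightarrow> 'a \<Rightarrow> complex"
  assumes scaleR_scaleC: "scaleR r x = complex_of_real r *\<^sub>C x"
    and scaleC_add_right: "c *\<^sub>C (x + y) = c *\<^sub>C x + c *\<^sub>C y"
    and scaleC_add_left: "(c + d) *\<^sub>C x = c *\<^sub>C x + d *\<^sub>C x"
    and scaleC_scaleC: "c *\<^sub>C (d *\<^sub>C x) = (c * d) *\<^sub>C x"
    and scaleC_one: "1 *\<^sub>C x = x"
    and cinner_commute: "cinner x y = cnj (cinner y x)"
    and cinner_add_right: "cinner x (y + z) = cinner x y + cinner x z"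
    and cinner_scaleC_right: "cinner x (c *\<^sub>C y) = c * cinner x y"
    and cinner_ge_zero: "0 \<le> Re (cinner x x)"
    and cinner_eq_zero_iff: "cinner x x = 0 \<longleftrightarrow> x = 0"
    and norm_eq_sqrt_cinner: "norm x = sqrt (Re (cinner x x))"

global_interpretation complex_vector: vector_space "scaleC :: complex \<Rightarrow> 'a \<Rightarrow> 'a::chilbert_space"
  by standard (simp_all add: scaleC_add_right scaleC_add_left scaleC_scaleC scaleC_one)

abbreviation cspan :: "'a::chilbert_space set \<Rightarrow> 'a set" where
  "cspan \<equiv> module.span scaleC"

definition orthonormal_basis :: "'a::chilbert_space set \<Rightarrow> bool" where
  "orthonormal_basis E \<longleftrightarrow>
     (\<forall>e\<in>E. \<forall>f\<in>E. cinner e f = (if e = f then 1 else 0)) \<and> closure (cspan E) = UNIV"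

text \<open>The group with label \<open>J\<close> consists of the vectors \<open>\<Phi> J i\<close> with \<open>i \<in> I J\<close>; groups may have
  different sizes, finite or infinite.\<close>

definition grouped_basis :: "('j \<Rightarrow> 'i set) \<Rightarrow> ('j \<Rightarrow> 'i \<Rightarrow> 'a::chilbert_space) \<Rightarrow> bool" where
  "grouped_basis I \<Phi> \<longleftrightarrow>
     inj_on (\<lambda>(J, i). \<Phi> J i) (Sigma UNIV I) \<and>
     orthonormal_basis ((\<lambda>(J, i). \<Phi> J i) ` Sigma UNIV I)"

definition phase_cell ::
  "('j \<Rightarrow> 'i set) \<Rightarrow> ('j \<Rightarrow> 'i \<Rightarrow> 'a::chilbert_space) \<Rightarrow> 'j \<Rightarrow> 'a set" where
  "phase_cell I \<Phi> J = closure (cspan (\<Phi> J ` I J))"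

definition orthogonal_projector :: "'a::chilbert_space set \<Rightarrow> 'a \<Rightarrow> 'a" where
  "orthogonal_projector S \<psi> = (THE p. p \<in> S \<and> (\<forall>s\<in>S. cinner s (\<psi> - p) = 0))"

text \<open>The numbers \<open>a J\<close> may be unbounded, so operators are partial maps \<open>'a \<rightharpoonup> 'a\<close>. The operator
  \<open>\<Sum>\<^sub>J a J P\<^sub>J\<close> is defined on exactly those vectors for which the series converges
  (unconditionally) in norm.\<close>

definition coarse_observable ::
  "('j \<Rightarrow> 'i set) \<Rightarrow> ('j \<Rightarrow> 'i \<Rightarrow> 'a::chilbert_space) \<Rightarrow> ('j \<Rightarrow> real) \<Rightarrow> ('a \<rightharpoonup> 'a)" where
  "coarse_observable I \<Phi> a \<psi> =
     (let f = (\<lambda>J. complex_of_real (a J) *\<^sub>C orthogonal_projector (phase_cell I \<Phi> J) \<psi>)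
      in if f summable_on UNIV then Some (\<Sum>\<^sub>\<infinity>J. f J) else None)"

definition coarse_macro_observables ::
  "('j \<Rightarrow> 'i set) \<Rightarrow> ('j \<Rightarrow> 'i \<Rightarrow> 'a::chilbert_space) \<Rightarrow> ('a \<rightharpoonup> 'a) set" where
  "coarse_macro_observables I \<Phi> = range (coarse_observable I \<Phi>)"

text \<open>\<open>(\<psi>|A|\<psi>)\<close>, meaningful only for \<open>\<psi> \<in> dom A\<close>.\<close>

definition expectation :: "('a::chilbert_space \<rightharpoonup> 'a) \<Rightarrow> 'a \<Rightarrow> complex" where
  "expectation A \<psi> = cinner \<psi> (the (A \<psi>))"

text \<open>The operator \<open>|\<psi>\<rangle>\<langle>\<psi>|\<close>.\<close>

definition ket_bra :: "'a::chilbert_space \<Rightarrow> 'a \<Rightarrow> 'a" where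
  "ket_bra \<psi> \<phi> = cinner \<psi> \<phi> *\<^sub>C \<psi>"

text \<open>\<open>T\<close> is everywhere defined and its trace, computed in any orthonormal basis, is \<open>t\<close>.\<close>

definition has_trace :: "('a::chilbert_space \<rightharpoonup> 'a) \<Rightarrow> complex \<Rightarrow> bool" where
  "has_trace T t \<longleftrightarrow> dom T = UNIV \<and>
     (\<forall>E. orthonormal_basis E \<longrightarrow> ((\<lambda>e. cinner e (the (T e))) has_sum t) E)"

text \<open>The expectation value of \<open>A\<close> in the (not necessarily normalized) mixed state \<open>\<rho>\<close>
  is the trace of \<open>A \<circ> \<rho>\<close>.\<close>

definition has_mixture_expectation ::
  "('a::chilbert_space \<rightharpoonup> 'a) \<Rightarrow> ('a \<Rightarrow> 'a) \<Rightarrow> complex \<Rightarrow> bool" where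
  "has_mixture_expectation A \<rho> t \<longleftrightarrow> has_trace (\<lambda>\<phi>. A (\<rho> \<phi>)) t"

end

theory Submission imports Defs begin

text \<open>A vector \<open>x + y\<close> with \<open>x\<close>, \<open>y\<close> in two different (hence orthogonal) phase cells is mapped by
  \<open>\<Sum>\<^sub>K a K P\<^sub>K\<close> to \<open>a J x + a J' y\<close>, so no cross terms survive in the expectation value. For the
  mixture, \<open>A\<close> composed with the density operator is
  \<open>a J |\<Psi>\<^sub>1\<rangle>\<langle>\<Psi>\<^sub>1| + a J' |\<Psi>\<^sub>2\<rangle>\<langle>\<Psi>\<^sub>2|\<close>, whose trace is computed in any orthonormal basis by Parseval's
  identity.\<close>

section \<open>Inner product and norm\<close>

lemma cinner_zero_right [simp]: "cinner x (0::'a::chilbert_space) = 0"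
  using cinner_add_right[of x 0 0] by simp

lemma cinner_zero_left [simp]: "cinner 0 (x::'a::chilbert_space) = 0"
  by (subst cinner_commute) simp

lemma cinner_diff_right: "cinner x (y - z) = cinner x y - cinner (x::'a::chilbert_space) z"
  using cinner_add_right[of x "y - z" z] by simp

lemma cinner_add_left: "cinner (x + y) z = cinner x z + cinner (y::'a::chilbert_space) z"
  by (metis cinner_add_right cinner_commute complex_cnj_add)

lemma cinner_diff_left: "cinner (x - y) z = cinner x z - cinner (y::'a::chilbert_space) z"
  using cinner_add_left[of "x - y" y z] by simp

lemma cinner_scaleC_left: "cinner (c *\<^sub>C x) y = cnj c * cinner (x::'a::chilbert_space) y"
  by (metis cinner_scaleC_right cinner_commute complex_cnj_mult)

lemma cinner_sum_right: "cinner (x::'a::chilbert_space) (\<Sum>i\<in>F. f i) = (\<Sum>i\<in>F. cinner x (f i))"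
  by (induction F rule: infinite_finite_induct) (simp_all add: cinner_add_right)

text \<open>Conjugate symmetry makes \<open>cinner x x\<close> real, so the real part that defines
  the norm is all of it.\<close>

lemma cinner_self: "cinner x x = complex_of_real ((norm (x::'a::chilbert_space))\<^sup>2)"
proof -
  have "Im (cinner x x) = 0"
    using arg_cong[OF cinner_commute[of x x], of Im] by simp
  then show ?thesis
    by (simp add: norm_eq_sqrt_cinner cinner_ge_zero complex_eq_iff)
qed

lemma pythagoras:
  fixes x y :: "'a::chilbert_space"
  assumes "cinner x y = 0"
  shows "(norm (x + y))\<^sup>2 = (norm x)\<^sup>2 + (norm y)\<^sup>2"
proof -
  have "cinner y x = 0"
    using assms by (subst cinner_commute) simp
  then have "cinner (x + y) (x + y) = cinner x x + cinner y y"
    by (simp add: cinner_add_left cinner_add_right assms)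
  then show ?thesis
    by (simp add: cinner_self flip: of_real_add of_real_power)
qed

text \<open>The normed-space structure gives homogeneity for real scalars; for complex ones it comes
  from pulling \<open>c\<close> out of both arguments of the inner product.\<close>

lemma norm_scaleC: "norm (c *\<^sub>C x) = cmod c * norm (x::'a::chilbert_space)"
proof -
  have "cinner (c *\<^sub>C x) (c *\<^sub>C x) = (c * cnj c) * cinner x x"
    by (simp add: cinner_scaleC_left cinner_scaleC_right)
  then have "complex_of_real ((norm (c *\<^sub>C x))\<^sup>2) = complex_of_real ((cmod c * norm x)\<^sup>2)"
    by (simp only: cinner_self complex_norm_square[symmetric] power_mult_distrib of_real_mult)
  then have "(norm (c *\<^sub>C x))\<^sup>2 = (cmod c * norm x)\<^sup>2"
    by (simp only: of_real_eq_iff)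
  then show ?thesis
    by (simp add: power2_eq_iff_nonneg)
qed

lemma cinner_Cauchy_Schwarz: "cmod (cinner x y) \<le> norm x * norm (y::'a::chilbert_space)"
proof (cases "x = 0")
  case False
  \<comment> \<open>\<open>c *\<^sub>C x\<close> is the component of \<open>y\<close> along
    \<open>x\<close>. It is orthogonal to the remainder, so by Pythagoras it is no longer than
    \<open>y\<close>, which is the claim after multiplying by \<open>norm x\<close>.\<close>
  define c where "c = cinner x y / cinner x x"
  have nz: "cinner x x \<noteq> 0"
    using False by (simp add: cinner_eq_zero_iff)
  have "cinner (c *\<^sub>C x) (y - c *\<^sub>C x) = 0"
    using nz by (simp add: cinner_scaleC_left cinner_diff_right cinner_scaleC_right c_def)
  from pythagoras[OF this] have "(norm (c *\<^sub>C x))\<^sup>2 \<le> (norm y)\<^sup>2"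
    by simp
  then have "norm (c *\<^sub>C x) \<le> norm y"
    by (rule power2_le_imp_le) simp
  moreover have "cmod c = cmod (cinner x y) / (norm x)\<^sup>2"
    by (simp add: c_def norm_divide cinner_self norm_power)
  ultimately show ?thesis
    using False by (simp add: norm_scaleC field_simps power2_eq_square)
qed simp

section \<open>Continuity and closed linear spans\<close>

lemma bounded_linear_cinner_right: "bounded_linear (cinner (x::'a::chilbert_space))"
  by (rule bounded_linear_intro[where K = "norm x"])
    (simp_all add: cinner_add_right scaleR_scaleC cinner_scaleC_right scaleR_conv_of_real
      cinner_Cauchy_Schwarz mult.commute[of "norm _" "norm x"])

lemma bounded_linear_scaleC: "bounded_linear (scaleC c :: 'a::chilbert_space \<Rightarrow> 'a)"
  by (rule bounded_linear_intro[where K = "cmod c"])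
    (simp_all add: scaleC_add_right scaleR_scaleC scaleC_scaleC norm_scaleC mult.commute)

text \<open>The kernel of the continuous linear functional \<open>cinner z\<close> is a closed
  subspace, so once it contains \<open>S\<close> it contains the closed span.\<close>

lemma cinner_closure_cspan_eq_0:
  fixes z :: "'a::chilbert_space"
  assumes "\<And>s. s \<in> S \<Longrightarrow> cinner z s = 0" and "x \<in> closure (cspan S)"
  shows "cinner z x = 0"
proof -
  have "cspan S \<subseteq> {s. cinner z s = 0}"
    by (rule complex_vector.span_minimal)
      (auto simp: assms(1) complex_vector.subspace_def cinner_add_right cinner_scaleC_right)
  moreover have "closed {s. cinner z s = 0}"
    by (intro closed_Collect_eq continuous_intros
        linear_continuous_on bounded_linear_cinner_right)
  ultimately show ?thesis
    using closure_minimal assms(2) by blast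
qed

lemma closure_cspan_diff:
  fixes S :: "'a::chilbert_space set"
  assumes "x \<in> closure (cspan S)" "y \<in> closure (cspan S)"
  shows "x - y \<in> closure (cspan S)"
proof -
  obtain f g where fg: "\<And>n. f n \<in> cspan S" "f \<longlonglongrightarrow> x" "\<And>n. g n \<in> cspan S" "g \<longlonglongrightarrow> y"
    using assms unfolding closure_sequential by blast
  then have "(\<lambda>n. f n - g n) \<longlonglongrightarrow> x - y" "\<And>n. f n - g n \<in> cspan S"
    by (auto intro: tendsto_diff complex_vector.span_diff)
  then show ?thesis
    unfolding closure_sequential by (intro exI[of _ "\<lambda>n. f n - g n"]) simp
qed

lemma closure_cspan_scaleC:
  fixes S :: "'a::chilbert_space set"
  assumes "x \<in> closure (cspan S)"
  shows "c *\<^sub>C x \<in> closure (cspan S)"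
proof -
  obtain f where f: "\<And>n. f n \<in> cspan S" "f \<longlonglongrightarrow> x"
    using assms unfolding closure_sequential by blast
  then have "(\<lambda>n. c *\<^sub>C f n) \<longlonglongrightarrow> c *\<^sub>C x" "\<And>n. c *\<^sub>C f n \<in> cspan S"
    by (auto intro: bounded_linear.tendsto[OF bounded_linear_scaleC] complex_vector.span_scale)
  then show ?thesis
    unfolding closure_sequential by (intro exI[of _ "\<lambda>n. c *\<^sub>C f n"]) simp
qed

text \<open>Finite partial sums lie in the span and their limit in its closure. This places vectors
  given by an expansion in their phase cell.\<close>

lemma has_sum_in_closure_cspan:
  fixes f :: "'i \<Rightarrow> 'a::chilbert_space"
  assumes "((\<lambda>i. b i *\<^sub>C f i) has_sum x) S"
  shows "x \<in> closure (cspan (f ` S))"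
proof (rule Lim_in_closed_set)
  show "(sum (\<lambda>i. b i *\<^sub>C f i) \<longlongrightarrow> x) (finite_subsets_at_top S)"
    using assms by (simp add: has_sum_def)
  have "sum (\<lambda>i. b i *\<^sub>C f i) F \<in> closure (cspan (f ` S))" if "F \<subseteq> S" for F
    using that by (intro subsetD[OF closure_subset] complex_vector.span_sum
        complex_vector.span_scale complex_vector.span_base) blast
  then show "\<forall>\<^sub>F F in finite_subsets_at_top S. sum (\<lambda>i. b i *\<^sub>C f i) F \<in> closure (cspan (f ` S))"
    by (intro eventually_finite_subsets_at_top_weakI) simp
qed simp_all

section \<open>Orthonormal expansions and Parseval's identity\<close>

lemma has_sum_cmod_square:
  fixes f :: "'i \<Rightarrow> 'a::chilbert_space"
  assumes orth: "\<And>i j. i \<in> S \<Longrightarrow> j \<in> S \<Longrightarrow> cinner (f i) (f j) = (if i = j then 1 else 0)"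
    and x: "((\<lambda>i. b i *\<^sub>C f i) has_sum x) S"
  shows "((\<lambda>i. (cmod (b i))\<^sup>2) has_sum (norm x)\<^sup>2) S"
proof -
  have sum: "((\<lambda>i. b i * cinner z (f i)) has_sum cinner z x) S" for z
    using has_sum_bounded_linear[OF bounded_linear_cinner_right x, of z]
    by (simp add: cinner_scaleC_right o_def)
  have coeff: "cinner (f j) x = b j" if "j \<in> S" for j
  proof -
    \<comment> \<open>Orthonormality kills every term except \<open>i = j\<close>, so the series
      paired with \<open>f j\<close> reduces to a one-point sum.\<close>
    have "((\<lambda>i. b i * cinner (f j) (f i)) has_sum b j) S \<longleftrightarrow>
        ((\<lambda>i. b i) has_sum b j) {j}"
      using that by (intro has_sum_cong_neutral) (auto simp: orth)
    then show ?thesis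
      using has_sum_unique[OF sum[of "f j"]] has_sum_finite[of "{j}" b] by simp
  qed
  \<comment> \<open>Pairing the expansion with \<open>x\<close> itself gives the terms
    \<open>b i * cnj (b i)\<close>.\<close>
  have "((\<lambda>i. complex_of_real ((cmod (b i))\<^sup>2)) has_sum cinner x x) S \<longleftrightarrow>
      ((\<lambda>i. b i * cinner x (f i)) has_sum cinner x x) S"
  proof (rule has_sum_cong)
    fix i assume "i \<in> S"
    then have "cinner x (f i) = cnj (b i)"
      by (subst cinner_commute) (simp add: coeff)
    then show "complex_of_real ((cmod (b i))\<^sup>2) = b i * cinner x (f i)"
      by (simp only: complex_norm_square)
  qed
  then have "((\<lambda>i. complex_of_real ((cmod (b i))\<^sup>2)) has_sum complex_of_real ((norm x)\<^sup>2)) S"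
    using sum[of x] by (simp add: cinner_self)
  then show ?thesis
    by (simp only: has_sum_of_real_iff)
qed

text \<open>With \<open>p\<close> the Fourier sum, \<open>x - p\<close> is orthogonal to the span of
  \<open>G\<close>, which contains \<open>p - y\<close>; Pythagoras applies to
  \<open>x - y = (x - p) + (p - y)\<close>.\<close>

lemma orthonormal_best_approximation:
  fixes x :: "'a::chilbert_space"
  assumes "finite G"
    and orth: "\<And>e f. e \<in> G \<Longrightarrow> f \<in> G \<Longrightarrow> cinner e f = (if e = f then 1 else 0)"
    and y: "y \<in> cspan G"
  shows "norm (x - (\<Sum>e\<in>G. cinner e x *\<^sub>C e)) \<le> norm (x - y)"
proof -
  define p where "p = (\<Sum>e\<in>G. cinner e x *\<^sub>C e)"
  have "cinner e (x - p) = 0" if "e \<in> G" for e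
  proof -
    have "cinner e p = (\<Sum>f\<in>G. if e = f then cinner f x else 0)"
      unfolding p_def cinner_sum_right cinner_scaleC_right
      using that by (intro sum.cong) (auto simp: orth)
    also have "\<dots> = cinner e x"
      using \<open>finite G\<close> that by simp
    finally show ?thesis
      by (simp add: cinner_diff_right)
  qed
  then have "cinner (x - p) e = 0" if "e \<in> G" for e
    using that by (subst cinner_commute) simp
  moreover have "p - y \<in> cspan G"
    unfolding p_def
    by (intro complex_vector.span_diff y complex_vector.span_sum complex_vector.span_scale
        complex_vector.span_base)
  ultimately have "cinner (x - p) (p - y) = 0"
    using cinner_closure_cspan_eq_0[of G "x - p" "p - y"] closure_subset by blast
  from pythagoras[OF this] have "(norm (x - p))\<^sup>2 \<le> (norm (x - y))\<^sup>2"
    by simp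
  then show ?thesis
    unfolding p_def by (rule power2_le_imp_le) simp
qed

text \<open>Density yields an approximant supported on a finite \<open>F\<close>. For every finite
  \<open>G\<close> containing \<open>F\<close> the Fourier sum over \<open>G\<close> is at least as
  close by best approximation, which is convergence along the net of finite subsets.\<close>

lemma orthonormal_basis_expansion:
  fixes x :: "'a::chilbert_space"
  assumes E: "orthonormal_basis E"
  shows "((\<lambda>e. cinner e x *\<^sub>C e) has_sum x) E"
  unfolding has_sum_def tendsto_iff
proof (intro allI impI)
  fix \<epsilon> :: real assume "\<epsilon> > 0"
  have "x \<in> closure (cspan E)"
    using E by (simp add: orthonormal_basis_def)
  then obtain y where y: "y \<in> cspan E" "dist y x < \<epsilon>"
    using \<open>\<epsilon> > 0\<close> unfolding closure_approachable by blast
  then obtain F r where F: "finite F" "F \<subseteq> E" "y = (\<Sum>e\<in>F. r e *\<^sub>C e)"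
    unfolding complex_vector.span_explicit by blast
  have "dist (\<Sum>e\<in>G. cinner e x *\<^sub>C e) x < \<epsilon>" if "finite G" "F \<subseteq> G" "G \<subseteq> E" for G
  proof -
    have "y \<in> cspan G"
      unfolding F(3) using that
      by (intro complex_vector.span_sum complex_vector.span_scale complex_vector.span_base) blast
    then have "norm (x - (\<Sum>e\<in>G. cinner e x *\<^sub>C e)) \<le> norm (x - y)"
      using E that
      by (intro orthonormal_best_approximation) (auto simp: orthonormal_basis_def subset_iff)
    then show ?thesis
      using y(2) by (simp add: dist_norm norm_minus_commute)
  qed
  then show "\<forall>\<^sub>F G in finite_subsets_at_top E. dist (\<Sum>e\<in>G. cinner e x *\<^sub>C e) x < \<epsilon>"
    unfolding eventually_finite_subsets_at_top using F by blast
qed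

text \<open>The terms are written as products because \<open>cinner x e * cinner e x\<close> is the
  diagonal entry of \<open>ket_bra x\<close> at \<open>e\<close>; the sum is thus its trace, the
  same in every orthonormal basis.\<close>

lemma parseval:
  fixes x :: "'a::chilbert_space"
  assumes "orthonormal_basis E"
  shows "((\<lambda>e. cinner x e * cinner e x) has_sum complex_of_real ((norm x)\<^sup>2)) E"
proof -
  have "((\<lambda>e. (cmod (cinner e x))\<^sup>2) has_sum (norm x)\<^sup>2) E"
    using assms orthonormal_basis_expansion[OF assms, of x]
    by (intro has_sum_cmod_square[of E "\<lambda>e. e"]) (auto simp: orthonormal_basis_def)
  then have "((\<lambda>e. complex_of_real ((cmod (cinner e x))\<^sup>2)) has_sum complex_of_real ((norm x)\<^sup>2)) E"
    by (simp only: has_sum_of_real_iff)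
  moreover have "complex_of_real ((cmod (cinner e x))\<^sup>2) = cinner x e * cinner e x" for e
    by (simp only: complex_norm_square cinner_commute[symmetric] mult.commute)
  ultimately show ?thesis
    by simp
qed

section \<open>Projectors, phase cells and the action of coarse observables\<close>

lemma orthogonal_projector_eqI:
  fixes S :: "'a::chilbert_space set"
  assumes "p \<in> closure (cspan S)" and "\<And>s. s \<in> closure (cspan S) \<Longrightarrow> cinner s (\<psi> - p) = 0"
  shows "orthogonal_projector (closure (cspan S)) \<psi> = p"
  unfolding orthogonal_projector_def
proof (rule the_equality)
  \<comment> \<open>Both residuals are orthogonal to the closed span, and \<open>q - p\<close> lies
    in it, so \<open>q - p\<close> is orthogonal to itself.\<close>
  fix q assume q: "q \<in> closure (cspan S) \<and> (\<forall>s\<in>closure (cspan S). cinner s (\<psi> - q) = 0)"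
  then have "q - p \<in> closure (cspan S)"
    using assms(1) by (intro closure_cspan_diff) auto
  then have "cinner (q - p) (\<psi> - p) - cinner (q - p) (\<psi> - q) = 0"
    using q assms(2) by simp
  then have "cinner (q - p) (q - p) = 0"
    by (simp flip: cinner_diff_right)
  then show "q = p"
    by (simp add: cinner_eq_zero_iff)
qed (use assms in blast)

text \<open>Orthonormality is stated for the set of basis vectors; injectivity of the indexing
  converts equality of vectors into equality of index pairs.\<close>

lemma grouped_basis_cinner:
  assumes "grouped_basis I \<Phi>" "i \<in> I K" "i' \<in> I L"
  shows "cinner (\<Phi> K i) (\<Phi> L i') = (if K = L \<and> i = i' then 1 else 0)"
proof -
  have "\<Phi> K i = \<Phi> L i' \<longleftrightarrow> K = L \<and> i = i'"
    using assms inj_onD[of "\<lambda>(J, i). \<Phi> J i" "Sigma UNIV I" "(K, i)" "(L, i')"]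
    by (auto simp: grouped_basis_def)
  moreover have "\<Phi> K i \<in> (\<lambda>(J, i). \<Phi> J i) ` Sigma UNIV I" "\<Phi> L i' \<in> (\<lambda>(J, i). \<Phi> J i) ` Sigma UNIV I"
    using assms by force+
  ultimately show ?thesis
    using assms(1) unfolding grouped_basis_def orthonormal_basis_def by metis
qed

text \<open>Orthogonality passes from basis vectors to closed spans one argument at a time, with
  conjugate symmetry to exchange the arguments.\<close>

lemma phase_cells_orthogonal:
  assumes "grouped_basis I \<Phi>" "x \<in> phase_cell I \<Phi> K" "y \<in> phase_cell I \<Phi> L" "K \<noteq> L"
  shows "cinner x y = 0"
proof -
  have "cinner (\<Phi> K i) y = 0" if "i \<in> I K" for i
    using assms(3) unfolding phase_cell_def
    by (rule cinner_closure_cspan_eq_0[rotated])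
      (use assms that in \<open>auto simp: grouped_basis_cinner\<close>)
  then have "cinner y (\<Phi> K i) = 0" if "i \<in> I K" for i
    using that by (subst cinner_commute) simp
  then have "cinner y x = 0"
    using assms(2) cinner_closure_cspan_eq_0[of "\<Phi> K ` I K" y x] unfolding phase_cell_def by blast
  then show ?thesis
    by (subst cinner_commute) simp
qed

lemma zero_in_phase_cell: "0 \<in> phase_cell I \<Phi> K"
  unfolding phase_cell_def by (intro subsetD[OF closure_subset] complex_vector.span_zero)

lemma coarse_observable_add:
  assumes basis: "grouped_basis I \<Phi>" and "J \<noteq> J'"
    and x: "x \<in> phase_cell I \<Phi> J" and y: "y \<in> phase_cell I \<Phi> J'"
  shows "coarse_observable I \<Phi> a (x + y) =
    Some (complex_of_real (a J) *\<^sub>C x + complex_of_real (a J') *\<^sub>C y)"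
proof -
  define f where "f K = complex_of_real (a K) *\<^sub>C orthogonal_projector (phase_cell I \<Phi> K) (x + y)"
    for K
  have projI: "orthogonal_projector (phase_cell I \<Phi> K) (x + y) = p"
    if "p \<in> phase_cell I \<Phi> K" "\<And>s. s \<in> phase_cell I \<Phi> K \<Longrightarrow> cinner s (x + y - p) = 0" for K p
    using that unfolding phase_cell_def by (rule orthogonal_projector_eqI)
  note orth = phase_cells_orthogonal[OF basis]
  have "orthogonal_projector (phase_cell I \<Phi> J) (x + y) = x"
    using \<open>J \<noteq> J'\<close> x y by (intro projI) (auto intro: orth)
  moreover have "orthogonal_projector (phase_cell I \<Phi> J') (x + y) = y"
    using \<open>J \<noteq> J'\<close>[symmetric] x y by (intro projI) (auto intro: orth)
  moreover have "orthogonal_projector (phase_cell I \<Phi> K) (x + y) = 0" if "K \<noteq> J" "K \<noteq> J'" for K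
    using that x y by (intro projI) (auto simp: cinner_add_right zero_in_phase_cell orth)
  ultimately have f: "f J = complex_of_real (a J) *\<^sub>C x" "f J' = complex_of_real (a J') *\<^sub>C y"
      "\<And>K. K \<noteq> J \<Longrightarrow> K \<noteq> J' \<Longrightarrow> f K = 0"
    by (simp_all add: f_def)
  \<comment> \<open>At most two terms of the series are nonzero, so it converges however fast the
    numbers \<open>a K\<close> grow, and \<open>x + y\<close> is in the domain.\<close>
  have "(f has_sum (f J + f J')) {J, J'}"
    using has_sum_finite[of "{J, J'}" f] \<open>J \<noteq> J'\<close> by simp
  moreover have "(f has_sum (f J + f J')) UNIV \<longleftrightarrow> (f has_sum (f J + f J')) {J, J'}"
    by (rule has_sum_cong_neutral) (auto simp: f)
  ultimately have "(f has_sum (f J + f J')) UNIV"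
    by simp
  then have "f summable_on UNIV" "infsum f UNIV = f J + f J'"
    by (auto simp: summable_on_def infsumI)
  then show ?thesis
    unfolding coarse_observable_def f_def[symmetric] by (simp add: f)
qed

section \<open>Expectation values of the superposition and the mixture\<close>

theorem mainTheorem1:
  fixes I :: "'j \<Rightarrow> 'i set"
    and \<Phi> :: "'j \<Rightarrow> 'i \<Rightarrow> 'h::chilbert_space"
    and J J' :: 'j
    and b1 b2 :: "'i \<Rightarrow> complex"
    and \<Psi>1 \<Psi>2 \<Psi> :: 'h
    and A :: "'h \<rightharpoonup> 'h"
    and a :: "'j \<Rightarrow> real"
  assumes basis: "grouped_basis I \<Phi>"
    and different: "J \<noteq> J'"
    and cell1: "((\<lambda>i. b1 i *\<^sub>C \<Phi> J i) has_sum \<Psi>1) (I J)"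
    and cell2: "((\<lambda>i. b2 i *\<^sub>C \<Phi> J' i) has_sum \<Psi>2) (I J')"
    and superposition: "\<Psi> = \<Psi>1 + \<Psi>2"
    and observable: "A \<in> coarse_macro_observables I \<Phi>"
    and eigenvalue: "\<And>K i. i \<in> I K \<Longrightarrow> A (\<Phi> K i) = Some (complex_of_real (a K) *\<^sub>C \<Phi> K i)"
  shows "{\<Psi>, \<Psi>1, \<Psi>2} \<subseteq> dom A
    \<and> (\<lambda>i. (cmod (b1 i))\<^sup>2) summable_on I J
    \<and> (\<lambda>i. (cmod (b2 i))\<^sup>2) summable_on I J'
    \<and> expectation A \<Psi> =
        complex_of_real ((\<Sum>\<^sub>\<infinity>i\<in>I J. (cmod (b1 i))\<^sup>2) * a J + (\<Sum>\<^sub>\<infinity>i\<in>I J'. (cmod (b2 i))\<^sup>2) * a J')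
    \<and> expectation A \<Psi> = expectation A \<Psi>1 + expectation A \<Psi>2
    \<and> has_mixture_expectation A (\<lambda>\<phi>. ket_bra \<Psi>1 \<phi> + ket_bra \<Psi>2 \<phi>) (expectation A \<Psi>)"
proof -
  \<comment> \<open>Membership supplies some coefficients \<open>a'\<close>, a priori different from
    \<open>a\<close>. Values are computed with \<open>a'\<close> and converted at the end.\<close>
  obtain a' where A: "A = coarse_observable I \<Phi> a'"
    using observable by (auto simp: coarse_macro_observables_def)
  have cells: "\<Psi>1 \<in> phase_cell I \<Phi> J" "\<Psi>2 \<in> phase_cell I \<Phi> J'"
    using has_sum_in_closure_cspan[OF cell1] has_sum_in_closure_cspan[OF cell2]
    by (simp_all add: phase_cell_def)
  \<comment> \<open>Arbitrary \<open>c\<close> and \<open>d\<close> let one formula serve both the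
    states (coefficients 0 and 1) and the range of the density operator.\<close>
  have A_add: "A (c *\<^sub>C \<Psi>1 + d *\<^sub>C \<Psi>2) =
      Some ((complex_of_real (a' J) * c) *\<^sub>C \<Psi>1 + (complex_of_real (a' J') * d) *\<^sub>C \<Psi>2)" for c d
    unfolding A
    using coarse_observable_add[OF basis different, of "c *\<^sub>C \<Psi>1" "d *\<^sub>C \<Psi>2" a'] cells
    by (simp add: phase_cell_def closure_cspan_scaleC scaleC_scaleC)
  have orth: "cinner \<Psi>1 \<Psi>2 = 0" "cinner \<Psi>2 \<Psi>1 = 0"
    using phase_cells_orthogonal[OF basis cells different]
      phase_cells_orthogonal[OF basis cells(2,1) different[symmetric]] by simp_all

  have sum1: "((\<lambda>i. (cmod (b1 i))\<^sup>2) has_sum (norm \<Psi>1)\<^sup>2) (I J)"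
    by (rule has_sum_cmod_square[OF _ cell1]) (simp add: grouped_basis_cinner[OF basis])
  have sum2: "((\<lambda>i. (cmod (b2 i))\<^sup>2) has_sum (norm \<Psi>2)\<^sup>2) (I J')"
    by (rule has_sum_cmod_square[OF _ cell2]) (simp add: grouped_basis_cinner[OF basis])

  text \<open>On an empty group \<open>K\<close> the hypotheses leave \<open>a' K\<close> and \<open>a K\<close> unrelated.\<close>
  have a_eq: "a' K = a K" if "i \<in> I K" for K i
  proof -
    \<comment> \<open>\<open>coarse_observable_add\<close> takes two different labels; here the cell
      \<open>L\<close> carries the summand 0. It exists because \<open>J\<close> and
      \<open>J'\<close> cannot both equal \<open>K\<close>.\<close>
    obtain L where "K \<noteq> L"
      using different by metis
    moreover have "\<Phi> K i \<in> phase_cell I \<Phi> K"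
      using that unfolding phase_cell_def
      by (intro subsetD[OF closure_subset] complex_vector.span_base) blast
    ultimately have "A (\<Phi> K i) = Some (complex_of_real (a' K) *\<^sub>C \<Phi> K i)"
      unfolding A using coarse_observable_add[OF basis, of K L "\<Phi> K i" 0 a']
      by (simp add: zero_in_phase_cell)
    then have "complex_of_real (a' K) *\<^sub>C \<Phi> K i = complex_of_real (a K) *\<^sub>C \<Phi> K i"
      using eigenvalue[OF that] by (metis option.inject)
    then have "cinner (\<Phi> K i) (complex_of_real (a' K) *\<^sub>C \<Phi> K i) =
        cinner (\<Phi> K i) (complex_of_real (a K) *\<^sub>C \<Phi> K i)"
      by (rule arg_cong)
    then show ?thesis
      using that by (simp add: cinner_scaleC_right grouped_basis_cinner[OF basis])
  qed
  \<comment> \<open>The weight \<open>(norm \<Psi>1)\<^sup>2\<close> makes the comparison hold for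
    an empty group too: there \<open>\<Psi>1\<close> is an empty sum, hence 0.\<close>
  have a1: "(norm \<Psi>1)\<^sup>2 * a' J = (norm \<Psi>1)\<^sup>2 * a J"
  proof (cases "I J = {}")
    case True
    then have "\<Psi>1 = 0"
      using infsumI[OF cell1] by simp
    then show ?thesis by simp
  qed (use a_eq in auto)
  have a2: "(norm \<Psi>2)\<^sup>2 * a' J' = (norm \<Psi>2)\<^sup>2 * a J'"
  proof (cases "I J' = {}")
    case True
    then have "\<Psi>2 = 0"
      using infsumI[OF cell2] by simp
    then show ?thesis by simp
  qed (use a_eq in auto)

  have A_values: "A \<Psi>1 = Some (complex_of_real (a' J) *\<^sub>C \<Psi>1)"
      "A \<Psi>2 = Some (complex_of_real (a' J') *\<^sub>C \<Psi>2)"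
      "A \<Psi> = Some (complex_of_real (a' J) *\<^sub>C \<Psi>1 + complex_of_real (a' J') *\<^sub>C \<Psi>2)"
    using A_add[of 1 0] A_add[of 0 1] A_add[of 1 1]
    by (simp_all add: superposition scaleC_one)
  have exp1: "expectation A \<Psi>1 = complex_of_real ((norm \<Psi>1)\<^sup>2 * a' J)"
    and exp2: "expectation A \<Psi>2 = complex_of_real ((norm \<Psi>2)\<^sup>2 * a' J')"
    by (simp_all add: expectation_def A_values cinner_scaleC_right cinner_self)
  have exp: "expectation A \<Psi> = complex_of_real ((norm \<Psi>1)\<^sup>2 * a' J + (norm \<Psi>2)\<^sup>2 * a' J')"
    unfolding expectation_def A_values
    by (simp add: superposition cinner_add_left cinner_add_right cinner_scaleC_right cinner_self orth)

  have "has_mixture_expectation A (\<lambda>\<phi>. ket_bra \<Psi>1 \<phi> + ket_bra \<Psi>2 \<phi>) (expectation A \<Psi>)"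
    unfolding has_mixture_expectation_def has_trace_def
  proof (intro conjI allI impI)
    show "dom (\<lambda>\<phi>. A (ket_bra \<Psi>1 \<phi> + ket_bra \<Psi>2 \<phi>)) = UNIV"
      by (auto simp: ket_bra_def A_add)
    fix E :: "'h set" assume E: "orthonormal_basis E"
    \<comment> \<open>By \<open>A_add\<close> with \<open>c = cinner \<Psi>1 e\<close> and
      \<open>d = cinner \<Psi>2 e\<close>, these terms are the diagonal entries of \<open>A\<close>
      after the density operator; Parseval sums each rank-one part.\<close>
    have "((\<lambda>e. complex_of_real (a' J) * (cinner \<Psi>1 e * cinner e \<Psi>1)
          + complex_of_real (a' J') * (cinner \<Psi>2 e * cinner e \<Psi>2)) has_sum
        (complex_of_real (a' J) * complex_of_real ((norm \<Psi>1)\<^sup>2)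
          + complex_of_real (a' J') * complex_of_real ((norm \<Psi>2)\<^sup>2))) E"
      by (intro has_sum_add has_sum_cmult_right parseval E)
    then show "((\<lambda>e. cinner e (the (A (ket_bra \<Psi>1 e + ket_bra \<Psi>2 e)))) has_sum expectation A \<Psi>) E"
      by (simp add: ket_bra_def A_add cinner_add_right cinner_scaleC_right exp mult_ac)
  qed
  then show ?thesis
    using sum1 sum2 by (auto simp: A_values exp exp1 exp2 infsumI a1 a2 intro: has_sum_imp_summable)
qed

end
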